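(* Suppose the properties $P_1,\dots,P_p$ are pairwise disjoint and $W\in\mathbb{R}^{m\times n}_{\ge 0}$ is monotone and satisfies the Monge property. Then the linear program $$\max_{x\in\Omega_{m,n}}\sum_{i=1}^m\sum_{j=1}^n W_{ij}x_{ij}\quad\text{s.t.}\quad \sum_{i\in P_\ell}\sum_{j=1}^k x_{ij}\le U_{k\ell}\ \ \forall \ell\in[p],k\in[n]$$ has an optimal solution $x^\star\in\{0,1\}^{m\times n}$ (i.e. an integral optimal solution).
   Context: $m\ge n$ are positive integers, $P_1,\dots,P_p\subseteq[m]$, and $U_{k\ell}\in\mathbb{Z}_{\ge 0}$ for $k\in[n]$, $\ell\in[p]$. $\Omega_{m,n}=\{x\in[0,1]^{m\times n}: \sum_{j=1}^n x_{ij}\le 1\ \forall i\in[m],\ \sum_{i=1}^m x_{ij}=1\ \forall j\in[n]\}$. $W$ is monotone and satisfies the Monge property if for all $1\le i_1<i_2\le m$ and $1\le j_1<j_2\le n$: $W_{i_1j_1}\ge W_{i_2j_1}$, $W_{i_1j_1}\ge W_{i_1j_2}$, and $W_{i_1j_1}+W_{i_2j_2}\ge W_{i_1j_2}+W_{i_2j_1}$.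
   Formalization: The linear program is additionally assumed to be feasible; without this the claim fails, e.g. for p=1, P_1=[m], U=0, where no feasible point and hence no optimal solution exists. *)

theory Defs
  imports Complex_Main "HOL-Library.Disjoint_Sets"
begin

text \<open>Matrices in \<open>\<real>\<^sup>m\<^sup>\<times>\<^sup>n\<close> are functions \<open>nat \<Rightarrow> nat \<Rightarrow> real\<close>, only whose entries with row index in
  \<open>{1..m}\<close> and column index in \<open>{1..n}\<close> are meaningful; entries outside this range are never
  referred to.\<close>

definition Omega :: "nat \<Rightarrow> nat \<Rightarrow> (nat \<Rightarrow> nat \<Rightarrow> real) set" where
  "Omega m n = {x.
     (\<forall>i\<in>{1..m}. \<forall>j\<in>{1..n}. x i j \<in> {0..1}) \<and>
     (\<forall>i\<in>{1..m}. (\<Sum>j=1..n. x i j) \<le> 1) \<and>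
     (\<forall>j\<in>{1..n}. (\<Sum>i=1..m. x i j) = 1)}"

definition monotone_Monge :: "nat \<Rightarrow> nat \<Rightarrow> (nat \<Rightarrow> nat \<Rightarrow> real) \<Rightarrow> bool" where
  "monotone_Monge m n W \<longleftrightarrow>
     (\<forall>i1 i2 j1 j2. 1 \<le> i1 \<and> i1 < i2 \<and> i2 \<le> m \<and> 1 \<le> j1 \<and> j1 < j2 \<and> j2 \<le> n \<longrightarrow>
        W i1 j1 \<ge> W i2 j1 \<and>
        W i1 j1 \<ge> W i1 j2 \<and>
        W i1 j1 + W i2 j2 \<ge> W i1 j2 + W i2 j1)"

definition LP_feasible ::
  "nat \<Rightarrow> nat \<Rightarrow> nat \<Rightarrow> (nat \<Rightarrow> nat set) \<Rightarrow> (nat \<Rightarrow> nat \<Rightarrow> nat) \<Rightarrow> (nat \<Rightarrow> nat \<Rightarrow> real) set" where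
  "LP_feasible m n p P U = {x \<in> Omega m n.
     \<forall>l\<in>{1..p}. \<forall>k\<in>{1..n}. (\<Sum>i\<in>P l. \<Sum>j=1..k. x i j) \<le> real (U k l)}"

definition LP_objective ::
  "nat \<Rightarrow> nat \<Rightarrow> (nat \<Rightarrow> nat \<Rightarrow> real) \<Rightarrow> (nat \<Rightarrow> nat \<Rightarrow> real) \<Rightarrow> real" where
  "LP_objective m n W x = (\<Sum>i=1..m. \<Sum>j=1..n. W i j * x i j)"

definition LP_optimal ::
  "nat \<Rightarrow> nat \<Rightarrow> nat \<Rightarrow> (nat \<Rightarrow> nat set) \<Rightarrow> (nat \<Rightarrow> nat \<Rightarrow> nat) \<Rightarrow> (nat \<Rightarrow> nat \<Rightarrow> real)
     \<Rightarrow> (nat \<Rightarrow> nat \<Rightarrow> real) \<Rightarrow> bool" where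
  "LP_optimal m n p P U W x \<longleftrightarrow>
     is_arg_max (LP_objective m n W) (\<lambda>y. y \<in> LP_feasible m n p P U) x"

end

theory Submission
  imports Defs
begin

text \<open>Let \<open>S l k\<close> be the mass that a feasible \<open>x\<close> puts on class \<open>l\<close> in the first \<open>k\<close> columns. Summation
  by parts over the columns turns the objective into a sum over classes and columns \<open>k\<close> of
  fractional knapsacks of size \<open>S l k\<close> with antitone weights (this is the Monge property), so it is
  at most \<open>\<Sum>l. \<Sum>k. \<phi> l k (S l k)\<close>, where \<open>\<phi> l k\<close> is affine between consecutive integers. The
  constraints on \<open>S\<close> are those of a network flow, so \<open>S\<close> can be rounded, each entry to its floor or
  its ceiling, without decreasing this bound. For integral \<open>S\<close> filling the items of each class
  in order attains the bound simultaneously for all knapsacks and gives a 0/1 matrix. So every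
  feasible point is dominated by one of finitely many integral ones.\<close>

section \<open>Rounding of network flows\<close>

text \<open>Outflow minus inflow. Edges are abstract elements with endpoint maps, so parallel edges
  and loops are allowed, as contraction can create both; a loop contributes zero.\<close>

definition net :: "('e \<Rightarrow> 'v) \<Rightarrow> ('e \<Rightarrow> 'v) \<Rightarrow> 'e set \<Rightarrow> ('e \<Rightarrow> real) \<Rightarrow> 'v \<Rightarrow> real" where
  "net src tgt E f v = (\<Sum>e\<in>E. f e * (of_bool (src e = v) - of_bool (tgt e = v)))"

lemma net_insert:
  "finite E \<Longrightarrow> e \<notin> E \<Longrightarrow>
    net src tgt (insert e E) f v = f e * (of_bool (src e = v) - of_bool (tgt e = v)) + net src tgt E f v"
  by (simp add: net_def)

lemma net_add_scaled:
  "net src tgt E (\<lambda>e. f e + t * g e) v = net src tgt E f v + t * net src tgt E g v"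
  unfolding net_def sum_distrib_left sum.distrib[symmetric]
  by (rule sum.cong) (simp_all add: algebra_simps)

lemma net_cong: "(\<And>e. e \<in> E \<Longrightarrow> f e = g e) \<Longrightarrow> net src tgt E f v = net src tgt E g v"
  by (simp add: net_def cong: sum.cong)

text \<open>Induction by contraction of an edge: the hypothesis, that no non-loop edge is alone at
  one of its endpoints, survives contraction, and a circulation of the smaller graph lifts back. A
  loop is a circulation by itself.\<close>

lemma exists_circulation:
  fixes src tgt :: "'e \<Rightarrow> 'v"
  assumes "finite E" "E \<noteq> {}"
    and "\<And>e v. e \<in> E \<Longrightarrow> (src e = v) \<noteq> (tgt e = v) \<Longrightarrow>
           \<exists>e'\<in>E. e' \<noteq> e \<and> (src e' = v \<or> tgt e' = v)"
  shows "\<exists>d. (\<exists>e\<in>E. d e \<noteq> 0) \<and> (\<forall>v. net src tgt E d v = 0)"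
  using assms
proof (induction E arbitrary: src tgt rule: finite_psubset_induct)
  case (psubset E)
  show ?case
  proof (cases "\<exists>e\<in>E. src e = tgt e")
    case True
    then obtain e where e: "e \<in> E" "src e = tgt e" by blast
    have "net src tgt E (\<lambda>e'. of_bool (e' = e)) v = 0" for v
      unfolding net_def by (rule sum.neutral) (use e in auto)
    then show ?thesis
      using e by (intro exI[of _ "\<lambda>e'. of_bool (e' = e)"]) auto
  next
    case False
    obtain e0 where e0: "e0 \<in> E" using psubset.prems(1) by blast
    define u where "u = src e0"
    define v where "v = tgt e0"
    have uv: "u \<noteq> v" using False e0 by (auto simp: u_def v_def)
    \<comment> \<open>Identifying \<open>v\<close> with \<open>u\<close> contracts
      \<open>e0\<close>.\<close>
    define \<sigma> where "\<sigma> = (\<lambda>z. if z = v then u else z)"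
    define E' where "E' = E - {e0}"
    have E: "E = insert e0 E'" "e0 \<notin> E'" "finite E'"
      using e0 psubset.hyps(1) by (auto simp: E'_def)
    have at_u: "\<exists>e'\<in>E'. src e' = u \<or> tgt e' = u"
      using psubset.prems(2)[OF e0, of u] uv by (auto simp: u_def v_def E'_def)
    have at_v: "\<exists>e'\<in>E'. src e' = v \<or> tgt e' = v"
      using psubset.prems(2)[OF e0, of v] uv by (auto simp: u_def v_def E'_def)
    have "\<exists>d. (\<exists>e\<in>E'. d e \<noteq> 0) \<and> (\<forall>w. net (\<sigma> \<circ> src) (\<sigma> \<circ> tgt) E' d w = 0)"
    proof (rule psubset.IH)
      show "E' \<subset> E" using e0 by (auto simp: E'_def)
      show "E' \<noteq> {}" using at_u by auto
      fix e w
      assume e: "e \<in> E'" and w: "((\<sigma> \<circ> src) e = w) \<noteq> ((\<sigma> \<circ> tgt) e = w)"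
      show "\<exists>e'\<in>E'. e' \<noteq> e \<and> ((\<sigma> \<circ> src) e' = w \<or> (\<sigma> \<circ> tgt) e' = w)"
      proof (cases "w = u")
        case True
        \<comment> \<open>Exactly one end of \<open>e\<close> lies in the merged pair, so
          \<open>e\<close> misses \<open>u\<close> or misses \<open>v\<close>; the remaining edge at
          the missed vertex is then different from \<open>e\<close>.\<close>
        consider "src e \<noteq> u" "tgt e \<noteq> u" | "src e \<noteq> v" "tgt e \<noteq> v"
          using w True uv by (auto simp: \<sigma>_def split: if_splits)
        then show ?thesis
        proof cases
          case 1
          then show ?thesis using at_u uv True by (auto simp: \<sigma>_def)
        next
          case 2
          then show ?thesis using at_v uv True by (auto simp: \<sigma>_def)
        qed
      next
        case False
        then have "w \<noteq> v" using w by (auto simp: \<sigma>_def split: if_splits)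
        then have "(src e = w) \<noteq> (tgt e = w)"
          using w False by (auto simp: \<sigma>_def split: if_splits)
        then obtain e' where e': "e' \<in> E" "e' \<noteq> e" "src e' = w \<or> tgt e' = w"
          using psubset.prems(2)[of e w] e by (auto simp: E'_def)
        moreover have "e' \<noteq> e0" using e'(3) False \<open>w \<noteq> v\<close> by (auto simp: u_def v_def)
        ultimately show ?thesis
          using False \<open>w \<noteq> v\<close> by (intro bexI[of _ e']) (auto simp: \<sigma>_def E'_def)
      qed
    qed
    then obtain d where d: "\<exists>e\<in>E'. d e \<noteq> 0"
      and cons: "\<And>w. net (\<sigma> \<circ> src) (\<sigma> \<circ> tgt) E' d w = 0" by blast
    have net_u: "net src tgt E' d u + net src tgt E' d v = 0"
    proof -
      have "net src tgt E' d u + net src tgt E' d v = net (\<sigma> \<circ> src) (\<sigma> \<circ> tgt) E' d u"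
        unfolding net_def sum.distrib[symmetric]
        by (rule sum.cong) (use uv in \<open>auto simp: \<sigma>_def algebra_simps\<close>)
      then show ?thesis using cons by simp
    qed
    have net_w: "net src tgt E' d w = 0" if "w \<noteq> u" "w \<noteq> v" for w
    proof -
      have "net src tgt E' d w = net (\<sigma> \<circ> src) (\<sigma> \<circ> tgt) E' d w"
        unfolding net_def by (rule sum.cong) (use that in \<open>auto simp: \<sigma>_def\<close>)
      then show ?thesis using cons by simp
    qed
    \<comment> \<open>Balance at the merged vertex makes the imbalances at \<open>u\<close> and
      \<open>v\<close> opposite, and \<open>e0\<close>, running from \<open>u\<close> to
      \<open>v\<close>, carries just the amount that cancels both.\<close>
    define d' where "d' = d(e0 := - net src tgt E' d u)"
    have same: "net src tgt E' d' w = net src tgt E' d w" for w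
      by (rule net_cong) (use E in \<open>auto simp: d'_def\<close>)
    have "net src tgt E d' w = 0" for w
      unfolding E(1) net_insert[OF E(3,2)] same
      using net_u net_w[of w] uv
      by (cases "w = u"; cases "w = v") (auto simp: d'_def simp flip: u_def v_def)
    moreover have "\<exists>e\<in>E. d' e \<noteq> 0" using d E by (auto simp: d'_def)
    ultimately show ?thesis by blast
  qed
qed

text \<open>If exactly one non-loop edge at a vertex carried a fractional value, the net flow there would
  be fractional; hence the fractional edges support a circulation, along which the flow is pushed
  in the direction that does not decrease the objective until some edge becomes integral.\<close>

lemma network_rounding:
  fixes src tgt :: "'e \<Rightarrow> 'v" and x c :: "'e \<Rightarrow> real"
  assumes "finite E" and "\<And>v. net src tgt E x v \<in> \<int>"
  shows "\<exists>y. (\<forall>e\<in>E. y e \<in> \<int> \<and> of_int \<lfloor>x e\<rfloor> \<le> y e \<and> y e \<le> of_int \<lceil>x e\<rceil>) \<and>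
    (\<forall>v. net src tgt E y v = net src tgt E x v) \<and>
    (\<Sum>e\<in>E. c e * x e) \<le> (\<Sum>e\<in>E. c e * y e)"
  using assms(2)
proof (induction "card {e\<in>E. x e \<notin> \<int>}" arbitrary: x rule: less_induct)
  case less
  define F where "F = {e\<in>E. x e \<notin> \<int>}"
  have F: "finite F" "F \<subseteq> E" using assms(1) by (auto simp: F_def)
  show ?case
  proof (cases "F = {}")
    case True
    then have "x e \<in> \<int>" if "e \<in> E" for e using that by (auto simp: F_def)
    then show ?thesis by (intro exI[of _ x]) (auto simp: le_of_int_ceiling)
  next
    case False
    have "\<exists>d. (\<exists>e\<in>F. d e \<noteq> 0) \<and> (\<forall>v. net src tgt F d v = 0)"
    proof (rule exists_circulation[OF F(1) False])
      fix e v
      assume e: "e \<in> F" and v: "(src e = v) \<noteq> (tgt e = v)"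
      show "\<exists>e'\<in>F. e' \<noteq> e \<and> (src e' = v \<or> tgt e' = v)"
      proof (rule ccontr)
        assume none: "\<not> ?thesis"
        have "net src tgt (E - {e}) x v \<in> \<int>"
          unfolding net_def
        proof (rule Ints_sum)
          fix a assume a: "a \<in> E - {e}"
          show "x a * (of_bool (src a = v) - of_bool (tgt a = v)) \<in> \<int>"
          proof (cases "a \<in> F")
            case True
            then show ?thesis using none a by auto
          next
            case False
            then have "x a \<in> \<int>" using a by (auto simp: F_def)
            then show ?thesis by (intro Ints_mult Ints_diff) auto
          qed
        qed
        moreover have "net src tgt E x v =
            x e * (of_bool (src e = v) - of_bool (tgt e = v)) + net src tgt (E - {e}) x v"
          using net_insert[of "E - {e}" e src tgt x v] assms(1) e F(2)
          by (auto simp: insert_absorb)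
        ultimately have "x e * (of_bool (src e = v) - of_bool (tgt e = v)) \<in> \<int>"
          using less.prems[of v] by (metis Ints_diff add_diff_cancel_right')
        then have "x e \<in> \<int>" using v by (auto simp: minus_in_Ints_iff split: if_splits)
        then show False using e by (simp add: F_def)
      qed
    qed
    then obtain d1 where d1: "\<exists>e\<in>F. d1 e \<noteq> 0" "\<And>v. net src tgt F d1 v = 0" by blast
    \<comment> \<open>Negating a circulation gives a circulation, so the sign can be chosen to make
      its objective nonnegative; edges outside \<open>F\<close> are left unchanged.\<close>
    define d where "d = (\<lambda>e. if e \<in> F then (if 0 \<le> (\<Sum>e\<in>F. c e * d1 e) then d1 e else - d1 e) else 0)"
    have d_nz: "\<exists>e\<in>F. d e \<noteq> 0" using d1(1) by (auto simp: d_def)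
    have d_out: "d e = 0" if "e \<notin> F" for e using that by (simp add: d_def)
    have d_net: "net src tgt E d v = 0" for v
    proof -
      have "net src tgt E d v = net src tgt F d v"
        unfolding net_def by (rule sum.mono_neutral_right) (use F assms(1) d_out in auto)
      also have "\<dots> = (if 0 \<le> (\<Sum>e\<in>F. c e * d1 e) then 1 else - 1) * net src tgt F d1 v"
        unfolding net_def sum_distrib_left by (rule sum.cong) (auto simp: d_def)
      finally show ?thesis using d1(2) by simp
    qed
    have d_obj: "0 \<le> (\<Sum>e\<in>E. c e * d e)"
    proof -
      have "(\<Sum>e\<in>E. c e * d e) = (\<Sum>e\<in>F. c e * d e)"
        by (rule sum.mono_neutral_right) (use F assms(1) d_out in auto)
      also have "\<dots> = (if 0 \<le> (\<Sum>e\<in>F. c e * d1 e) then 1 else - 1) * (\<Sum>e\<in>F. c e * d1 e)"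
        unfolding sum_distrib_left by (rule sum.cong) (auto simp: d_def)
      finally show ?thesis by auto
    qed
    \<comment> \<open>For \<open>d e\<close> nonzero this is the step length at which edge
      \<open>e\<close>, moved along \<open>d\<close>, reaches its ceiling or floor. The minimum over
      \<open>D\<close> respects all these bounds and makes at least one fractional edge
      integral.\<close>
    define room where
      "room e = (if 0 < d e then of_int \<lceil>x e\<rceil> - x e else x e - of_int \<lfloor>x e\<rfloor>) / \<bar>d e\<bar>" for e
    define D where "D = {e\<in>F. d e \<noteq> 0}"
    have D: "finite D" "D \<noteq> {}" using F d_nz by (auto simp: D_def)
    define t where "t = Min (room ` D)"
    have t_le: "t \<le> room e" if "e \<in> D" for e using that D by (auto simp: t_def)
    have "t \<in> room ` D" unfolding t_def by (rule Min_in) (use D in auto)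
    then obtain e0 where e0: "e0 \<in> D" "t = room e0" by auto
    have t0: "0 \<le> t" unfolding e0(2) room_def by auto
    define z where "z = (\<lambda>e. x e + t * d e)"
    have z: "of_int \<lfloor>x e\<rfloor> \<le> z e \<and> z e \<le> of_int \<lceil>x e\<rceil>" for e
    proof (cases "e \<in> D")
      case False
      then have "d e = 0" using d_out by (auto simp: D_def)
      then show ?thesis by (simp add: z_def)
    next
      case True
      consider "0 < d e" | "d e < 0" using True by (force simp: D_def)
      then show ?thesis
      proof cases
        case 1
        then have "t * d e \<le> of_int \<lceil>x e\<rceil> - x e"
          using t_le[OF True] by (simp add: room_def field_simps)
        moreover have "0 \<le> t * d e" using 1 t0 by simp
        ultimately show ?thesis using of_int_floor_le[of "x e"] unfolding z_def by linarith
      next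
        case 2
        then have "- (t * d e) \<le> x e - of_int \<lfloor>x e\<rfloor>"
          using t_le[OF True] by (simp add: room_def field_simps)
        moreover have "t * d e \<le> 0" using 2 t0 by (simp add: mult_nonneg_nonpos)
        ultimately show ?thesis using le_of_int_ceiling[of "x e"] unfolding z_def by linarith
      qed
    qed
    have z_e0: "z e0 \<in> \<int>"
    proof -
      have "d e0 \<noteq> 0" using e0(1) by (simp add: D_def)
      then have "z e0 = of_int (if 0 < d e0 then \<lceil>x e0\<rceil> else \<lfloor>x e0\<rfloor>)"
        by (auto simp: z_def e0(2) room_def)
      then show ?thesis by simp
    qed
    have "{e\<in>E. z e \<notin> \<int>} \<subset> F"
    proof
      show "{e\<in>E. z e \<notin> \<int>} \<subseteq> F"
      proof (clarify, rule ccontr)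
        fix e assume "e \<in> E" "z e \<notin> \<int>" "e \<notin> F"
        then show False using d_out[of e] by (auto simp: z_def F_def)
      qed
      show "{e\<in>E. z e \<notin> \<int>} \<noteq> F" using z_e0 e0(1) by (auto simp: D_def)
    qed
    then have card_less: "card {e\<in>E. z e \<notin> \<int>} < card {e\<in>E. x e \<notin> \<int>}"
      using psubset_card_mono[OF F(1)] unfolding F_def by blast
    have z_net: "net src tgt E z v = net src tgt E x v" for v
      unfolding z_def net_add_scaled using d_net by simp
    have "\<exists>y. (\<forall>e\<in>E. y e \<in> \<int> \<and> of_int \<lfloor>z e\<rfloor> \<le> y e \<and> y e \<le> of_int \<lceil>z e\<rceil>) \<and>
      (\<forall>v. net src tgt E y v = net src tgt E z v) \<and>
      (\<Sum>e\<in>E. c e * z e) \<le> (\<Sum>e\<in>E. c e * y e)"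
      by (rule less.hyps[OF card_less]) (use z_net less.prems in simp)
    then obtain y where y: "\<And>e. e \<in> E \<Longrightarrow> y e \<in> \<int> \<and> of_int \<lfloor>z e\<rfloor> \<le> y e \<and> y e \<le> of_int \<lceil>z e\<rceil>"
      "\<And>v. net src tgt E y v = net src tgt E z v" "(\<Sum>e\<in>E. c e * z e) \<le> (\<Sum>e\<in>E. c e * y e)"
      by blast
    have "of_int \<lfloor>x e\<rfloor> \<le> y e \<and> y e \<le> of_int \<lceil>x e\<rceil>" if "e \<in> E" for e
    proof -
      have "\<lfloor>x e\<rfloor> \<le> \<lfloor>z e\<rfloor>" "\<lceil>z e\<rceil> \<le> \<lceil>x e\<rceil>"
        using z[of e] by (simp_all add: le_floor_iff ceiling_le_iff)
      then show ?thesis using y(1)[OF that] by (meson of_int_le_iff order_trans)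
    qed
    moreover have "(\<Sum>e\<in>E. c e * z e) = (\<Sum>e\<in>E. c e * x e) + t * (\<Sum>e\<in>E. c e * d e)"
      by (simp add: z_def sum.distrib sum_distrib_left algebra_simps)
    ultimately show ?thesis
      using y z_net d_obj t0 by (intro exI[of _ y]) (auto intro: order_trans[rotated])
  qed
qed

text \<open>Both the prefix masses and their increments are edge flows. Rounding edge by edge
  therefore keeps increments nonnegative, and equal net flows preserve the recursion along each
  class and the unit mass of each column.\<close>

lemma round_prefix_sums:
  fixes S c :: "'l \<Rightarrow> nat \<Rightarrow> real"
  assumes L: "finite L"
    and S0: "\<And>l. l \<in> L \<Longrightarrow> S l 0 = 0"
    and S_mono: "\<And>l k. l \<in> L \<Longrightarrow> k < n \<Longrightarrow> S l k \<le> S l (Suc k)"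
    and S_sum: "\<And>k. k \<le> n \<Longrightarrow> (\<Sum>l\<in>L. S l k) = k"
  obtains T where "\<And>l. l \<in> L \<Longrightarrow> T l 0 = 0"
    "\<And>l k. l \<in> L \<Longrightarrow> k < n \<Longrightarrow> T l k \<le> T l (Suc k)"
    "\<And>l k. l \<in> L \<Longrightarrow> k \<le> n \<Longrightarrow>
       T l k \<in> \<int> \<and> of_int \<lfloor>S l k\<rfloor> \<le> T l k \<and> T l k \<le> of_int \<lceil>S l k\<rceil>"
    "\<And>k. k \<le> n \<Longrightarrow> (\<Sum>l\<in>L. T l k) = k"
    "(\<Sum>l\<in>L. \<Sum>k<n. c l (Suc k) * S l (Suc k)) \<le> (\<Sum>l\<in>L. \<Sum>k<n. c l (Suc k) * T l (Suc k))"
proof -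
  \<comment> \<open>Vertex \<open>(None, k)\<close> stands for column \<open>Suc k\<close> (\<open>(None, n)\<close> is the sink) and \<open>(Some l, k)\<close> for
    class \<open>l\<close> after that column; \<open>Inr (l, k)\<close> carries the mass column \<open>Suc k\<close> sends to class \<open>l\<close>,
    \<open>Inl (l, k)\<close> the accumulated mass \<open>S l (Suc k)\<close>.\<close>
  define E :: "('l \<times> nat + 'l \<times> nat) set" where "E = (L \<times> {..<n}) <+> (L \<times> {..<n})"
  define src :: "'l \<times> nat + 'l \<times> nat \<Rightarrow> 'l option \<times> nat" where
    "src = case_sum (\<lambda>(l,k). (Some l, k)) (\<lambda>(l,k). (None, k))"
  define tgt :: "'l \<times> nat + 'l \<times> nat \<Rightarrow> 'l option \<times> nat" where
    "tgt = case_sum (\<lambda>(l,k). if Suc k = n then (None, n) else (Some l, Suc k)) (\<lambda>(l,k). (Some l, k))"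
  define x :: "'l \<times> nat + 'l \<times> nat \<Rightarrow> real" where
    "x = case_sum (\<lambda>(l,k). S l (Suc k)) (\<lambda>(l,k). S l (Suc k) - S l k)"
  define cost :: "'l \<times> nat + 'l \<times> nat \<Rightarrow> real" where
    "cost = case_sum (\<lambda>(l,k). c l (Suc k)) (\<lambda>_. 0)"
  have "finite E" using L by (simp add: E_def)
  have sum_E: "(\<Sum>e\<in>E. h e) = (\<Sum>l\<in>L. \<Sum>k<n. h (Inl (l,k))) + (\<Sum>l\<in>L. \<Sum>k<n. h (Inr (l,k)))"
    for h :: "_ \<Rightarrow> real"
    unfolding E_def using L by (simp add: sum.Plus sum.cartesian_product)
  have net_split: "net src tgt E f v =
      (\<Sum>l\<in>L. \<Sum>k<n. f (Inl (l,k)) * (of_bool ((Some l, k) = v) -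
         of_bool ((if Suc k = n then (None, n) else (Some l, Suc k)) = v))) +
      (\<Sum>l\<in>L. \<Sum>k<n. f (Inr (l,k)) * (of_bool ((None, k) = v) - of_bool ((Some l, k) = v)))" for f v
    unfolding net_def sum_E by (simp add: src_def tgt_def)
  have net_col: "net src tgt E f (None, k) = (\<Sum>l\<in>L. f (Inr (l, k)))" if "k < n" for f k
  proof -
    have "(\<Sum>k'<n. f (Inl (l,k')) * (of_bool ((Some l, k') = (None, k)) -
         of_bool ((if Suc k' = n then (None, n) else (Some l, Suc k')) = (None, k)))) = 0" for l
      by (rule sum.neutral) (use that in auto)
    moreover have "(\<Sum>k'<n. f (Inr (l,k')) * (of_bool ((None, k') = (None, k)) -
        of_bool ((Some l, k') = (None, k)))) =
        (\<Sum>k'<n. if k' = k then f (Inr (l,k')) else 0)" for l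
      by (rule sum.cong) auto
    ultimately show ?thesis unfolding net_split using that by simp
  qed
  have net_class: "net src tgt E f (Some l, k) =
      f (Inl (l,k)) - (if k = 0 then 0 else f (Inl (l, k - 1))) - f (Inr (l,k))"
    if "k < n" "l \<in> L" for f k l
  proof -
    have 1: "(\<Sum>l'\<in>L. \<Sum>k'<n. f (Inr (l',k')) * (of_bool ((None, k') = (Some l, k)) -
        of_bool ((Some l', k') = (Some l, k)))) = - f (Inr (l,k))"
    proof -
      have "(\<Sum>k'<n. f (Inr (l',k')) * (of_bool ((None, k') = (Some l, k)) -
          of_bool ((Some l', k') = (Some l, k)))) = (if l' = l then - f (Inr (l,k)) else 0)" for l'
      proof -
        have "(\<Sum>k'<n. f (Inr (l',k')) * (of_bool ((None, k') = (Some l, k)) -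
          of_bool ((Some l', k') = (Some l, k)))) =
          (\<Sum>k'<n. if k' = k then (if l' = l then - f (Inr (l,k)) else 0) else 0)"
          by (rule sum.cong) auto
        then show ?thesis using that by (simp only: sum.delta finite_lessThan lessThan_iff if_True)
      qed
      then show ?thesis using that L by simp
    qed
    have 2: "(\<Sum>l'\<in>L. \<Sum>k'<n. f (Inl (l',k')) * (of_bool ((Some l', k') = (Some l, k)) -
        of_bool ((if Suc k' = n then (None, n) else (Some l', Suc k')) = (Some l, k)))) =
        f (Inl (l,k)) - (if k = 0 then 0 else f (Inl (l, k - 1)))"
    proof -
      have "(\<Sum>l'\<in>L. \<Sum>k'<n. f (Inl (l',k')) * (of_bool ((Some l', k') = (Some l, k)) -
        of_bool ((if Suc k' = n then (None, n) else (Some l', Suc k')) = (Some l, k)))) =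
        (\<Sum>l'\<in>L. if l' = l then (\<Sum>k'<n. (if k' = k then f (Inl (l',k')) else 0) -
           (if k' = k - 1 then if k = 0 then 0 else f (Inl (l', k')) else 0)) else 0)"
        by (rule sum.cong) (use that in \<open>auto intro!: sum.cong sum.neutral\<close>)
      then show ?thesis using that L by (simp add: sum_subtractf less_imp_diff_less)
    qed
    show ?thesis unfolding net_split 1 2 by simp
  qed
  have net_sink: "net src tgt E f (None, n) = - (\<Sum>l\<in>L. f (Inl (l, n - 1)))" if "0 < n" for f
  proof -
    have "(\<Sum>k'<n. f (Inl (l,k')) * (of_bool ((Some l, k') = (None, n)) -
         of_bool ((if Suc k' = n then (None, n) else (Some l, Suc k')) = (None, n)))) =
         (\<Sum>k'<n. if k' = n - 1 then - f (Inl (l,k')) else 0)" for l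
      by (rule sum.cong) (use that in auto)
    then show ?thesis unfolding net_split using that by (simp add: sum_negf)
  qed
  have net_out: "net src tgt E f v = 0" if "\<And>k. k \<le> n \<Longrightarrow> v \<noteq> (None, k)"
    "\<And>l k. l \<in> L \<Longrightarrow> k < n \<Longrightarrow> v \<noteq> (Some l, k)" for f v
    unfolding net_def
  proof (rule sum.neutral, rule ballI)
    fix e assume e: "e \<in> E"
    have "src e \<noteq> v \<and> tgt e \<noteq> v"
    proof (cases e)
      case (Inl lk)
      obtain l k where "lk = (l, k)" "l \<in> L" "k < n" using e Inl by (auto simp: E_def)
      then show ?thesis using that(1)[of n] that(2)[of l k] that(2)[of l "Suc k"] Inl
        by (auto simp: src_def tgt_def)
    next
      case (Inr lk)
      obtain l k where "lk = (l, k)" "l \<in> L" "k < n" using e Inr by (auto simp: E_def)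
      then show ?thesis using that(1)[of k] that(2)[of l k] Inr
        by (auto simp: src_def tgt_def)
    qed
    then show "f e * (of_bool (src e = v) - of_bool (tgt e = v)) = 0" by simp
  qed
  \<comment> \<open>Flow is conserved at class vertices and each column vertex emits one unit. With
    total inflow \<open>n\<close> at the sink, all net flows are integers.\<close>
  have x_class: "net src tgt E x (Some l, k) = 0" if "k < n" "l \<in> L" for l k
    unfolding net_class[OF that] using S0 that by (auto simp: x_def)
  have x_col: "net src tgt E x (None, k) = 1" if "k < n" for k
    unfolding net_col[OF that] using S_sum[of k] S_sum[of "Suc k"] that
    by (simp add: x_def sum_subtractf)
  have "net src tgt E x v \<in> \<int>" for v
  proof -
    consider k where "v = (None, k)" "k < n" | "v = (None, n)" "0 < n" | "n = 0"
      | l k where "v = (Some l, k)" "k < n" "l \<in> L"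
      | "\<And>k. k \<le> n \<Longrightarrow> v \<noteq> (None, k)" "\<And>l k. l \<in> L \<Longrightarrow> k < n \<Longrightarrow> v \<noteq> (Some l, k)"
      by (metis le_neq_implies_less neq0_conv)
    then show ?thesis
    proof cases
      case 2
      then show ?thesis using S_sum[of n] net_sink[of x] by (simp add: x_def)
    next
      case 3
      then show ?thesis by (simp add: net_split)
    qed (simp_all add: x_col x_class net_out)
  qed
  from network_rounding[OF \<open>finite E\<close> this, of cost] obtain y where
    y: "\<And>e. e \<in> E \<Longrightarrow> y e \<in> \<int> \<and> of_int \<lfloor>x e\<rfloor> \<le> y e \<and> y e \<le> of_int \<lceil>x e\<rceil>"
    and y_net: "\<And>v. net src tgt E y v = net src tgt E x v"
    and y_obj: "(\<Sum>e\<in>E. cost e * x e) \<le> (\<Sum>e\<in>E. cost e * y e)"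
    by blast
  \<comment> \<open>The index shifts by one: edge \<open>Inl (l, k)\<close> holds the mass after
    column \<open>Suc k\<close>. The value 0 at index 0 agrees with \<open>S0\<close>.\<close>
  define T where "T l k = (case k of 0 \<Rightarrow> 0 | Suc k' \<Rightarrow> y (Inl (l, k')))" for l k
  have T_Suc: "T l (Suc k) = T l k + y (Inr (l,k))" if "k < n" "l \<in> L" for l k
    using y_net[of "(Some l, k)"] x_class[OF that] net_class[OF that, of y]
    by (auto simp: T_def split: nat.split)
  have T_sum: "k \<le> n \<Longrightarrow> (\<Sum>l\<in>L. T l k) = k" for k
  proof (induction k)
    case 0
    then show ?case by (simp add: T_def)
  next
    case (Suc k)
    then have "(\<Sum>l\<in>L. T l (Suc k)) = (\<Sum>l\<in>L. T l k) + (\<Sum>l\<in>L. y (Inr (l,k)))"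
      by (simp add: T_Suc sum.distrib)
    also have "(\<Sum>l\<in>L. y (Inr (l,k))) = 1"
      using Suc.prems net_col[of k y] y_net[of "(None, k)"] x_col[of k] by simp
    finally show ?case using Suc by simp
  qed
  have T_mono: "T l k \<le> T l (Suc k)" if "l \<in> L" "k < n" for l k
  proof -
    have "Inr (l,k) \<in> E" using that by (auto simp: E_def)
    from y[OF this] have "of_int \<lfloor>S l (Suc k) - S l k\<rfloor> \<le> y (Inr (l,k))" by (simp add: x_def)
    moreover have "0 \<le> \<lfloor>S l (Suc k) - S l k\<rfloor>" using S_mono[OF that] by simp
    ultimately show ?thesis using T_Suc[OF that(2,1)] by (smt (verit) of_int_0_le_iff)
  qed
  have T_bounds: "T l k \<in> \<int> \<and> of_int \<lfloor>S l k\<rfloor> \<le> T l k \<and> T l k \<le> of_int \<lceil>S l k\<rceil>" if "l \<in> L" "k \<le> n" for l k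
  proof (cases k)
    case 0
    then show ?thesis using S0[OF that(1)] by (simp add: T_def)
  next
    case (Suc k')
    have "Inl (l,k') \<in> E" using that Suc by (auto simp: E_def)
    from y[OF this] show ?thesis by (simp add: x_def T_def Suc)
  qed
  have "(\<Sum>l\<in>L. \<Sum>k<n. c l (Suc k) * S l (Suc k)) \<le> (\<Sum>l\<in>L. \<Sum>k<n. c l (Suc k) * T l (Suc k))"
    using y_obj unfolding sum_E by (simp add: cost_def x_def T_def)
  with T_sum T_mono T_bounds show ?thesis
    by (intro that[of T]) (simp_all add: T_def)
qed

section \<open>Fractional knapsacks\<close>

definition clamp01 :: "real \<Rightarrow> real" where
  "clamp01 s = max 0 (min 1 s)"

text \<open>Positions count from 0, so filling \<open>Q\<close> in increasing order with total
  amount \<open>s\<close> gives item \<open>i\<close> the fraction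
  \<open>clamp01 (s - rank Q i)\<close>.\<close>

definition rank :: "nat set \<Rightarrow> nat \<Rightarrow> nat" where
  "rank Q i = card {i'\<in>Q. i' < i}"

lemma clamp01_bounds: "0 \<le> clamp01 s" "clamp01 s \<le> 1"
  by (auto simp: clamp01_def)

lemma clamp01_mono: "s \<le> t \<Longrightarrow> clamp01 s \<le> clamp01 t"
  by (auto simp: clamp01_def)

lemma clamp01_Ints: "s \<in> \<int> \<Longrightarrow> clamp01 s \<in> \<int>"
  by (auto simp: clamp01_def max_def min_def)

text \<open>The kinks of the shifted clamp lie at the integers \<open>t\<close> and
  \<open>t + 1\<close>, so each unit interval between integers lies on one of the three affine
  pieces. This turns the knapsack values into a linear objective for the rounding.\<close>

lemma clamp01_affine_between_integers:
  fixes s y :: real and t :: nat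
  assumes "of_int \<lfloor>s\<rfloor> \<le> y" "y \<le> of_int \<lceil>s\<rceil>"
  shows "clamp01 (y - t) = clamp01 (s - t) +
    (clamp01 (of_int \<lfloor>s\<rfloor> + 1 - t) - clamp01 (of_int \<lfloor>s\<rfloor> - t)) * (y - s)"
proof -
  define N where "N = \<lfloor>s\<rfloor>"
  have y: "of_int N \<le> y" "y \<le> of_int N + 1"
    using assms ceiling_diff_floor_le_1[of s] by (auto simp: N_def)
  have s: "of_int N \<le> s" "s < of_int N + 1" by (auto simp: N_def)
  consider "N < int t" | "N = int t" | "int t < N" by linarith
  then show ?thesis
  proof cases
    case 1
    then have "real_of_int N + 1 \<le> real t" by linarith
    then show ?thesis unfolding N_def[symmetric] using y s by (auto simp: clamp01_def max_def min_def)
  next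
    case 2
    then show ?thesis unfolding N_def[symmetric] using y s by (auto simp: clamp01_def max_def min_def)
  next
    case 3
    then have "real t + 1 \<le> real_of_int N" by linarith
    then show ?thesis unfolding N_def[symmetric] using y s by (auto simp: clamp01_def max_def min_def)
  qed
qed

lemma rank_strict_mono:
  assumes "finite Q" "i \<in> Q" "i < i'"
  shows "rank Q i < rank Q i'"
  unfolding rank_def using assms by (intro psubset_card_mono) auto

lemma bij_betw_rank:
  assumes "finite Q"
  shows "bij_betw (rank Q) Q {..<card Q}"
proof -
  have inj: "inj_on (rank Q) Q"
    using rank_strict_mono[OF assms] by (metis inj_onI less_irrefl linorder_neqE_nat)
  have "rank Q i < card Q" if "i \<in> Q" for i
    unfolding rank_def using assms that by (intro psubset_card_mono) auto
  then have "rank Q ` Q \<subseteq> {..<card Q}" by auto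
  then have "rank Q ` Q = {..<card Q}"
    by (intro card_subset_eq) (auto simp: card_image[OF inj])
  with inj show ?thesis by (simp add: bij_betw_def)
qed

text \<open>Ranks run through \<open>0, ..., card Q - 1\<close>, so the sum can be taken over
  positions, where partial sums equal \<open>min s N\<close>.\<close>

lemma sum_clamp01_rank:
  fixes s :: real
  assumes "finite Q" "0 \<le> s" "s \<le> card Q"
  shows "(\<Sum>i\<in>Q. clamp01 (s - rank Q i)) = s"
proof -
  have "(\<Sum>t<N. clamp01 (s - real t)) = min s N" for N
    by (induction N) (use assms(2) in \<open>auto simp: clamp01_def min_def max_def\<close>)
  moreover have "(\<Sum>i\<in>Q. clamp01 (s - rank Q i)) = (\<Sum>t<card Q. clamp01 (s - real t))"
    using sum.reindex_bij_betw[OF bij_betw_rank[OF assms(1)], of "\<lambda>t. clamp01 (s - real t)"] by simp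
  ultimately show ?thesis using assms(3) by simp
qed

text \<open>Exchange argument around a critical item \<open>q\<close>: the greedy filling is full
  before \<open>q\<close> and empty after it, so each deviation from it has the same sign as the
  weight difference to \<open>q\<close>.\<close>

lemma fractional_knapsack:
  fixes X w :: "nat \<Rightarrow> real"
  assumes Q: "finite Q" and X: "\<And>i. i \<in> Q \<Longrightarrow> 0 \<le> X i \<and> X i \<le> 1"
    and w: "\<And>i i'. i \<in> Q \<Longrightarrow> i' \<in> Q \<Longrightarrow> i < i' \<Longrightarrow> w i' \<le> w i"
  shows "(\<Sum>i\<in>Q. w i * X i) \<le> (\<Sum>i\<in>Q. w i * clamp01 (sum X Q - rank Q i))"
proof (cases "Q = {}")
  case False
  define s where "s = sum X Q"
  define c where "c i = clamp01 (s - rank Q i)" for i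
  have s: "0 \<le> s" "s \<le> card Q"
    using sum_nonneg[of Q X] sum_bounded_above[of Q X 1] X by (auto simp: s_def)
  have "card Q > 0" using Q False by (simp add: card_gt_0_iff)
  \<comment> \<open>The critical item has rank \<open>nat \<lfloor>s\<rfloor>\<close>; the cap
    covers \<open>s = card Q\<close>, where no item has that rank.\<close>
  then have "min (nat \<lfloor>s\<rfloor>) (card Q - 1) \<in> rank Q ` Q"
    using bij_betw_rank[OF Q] by (auto simp: bij_betw_def)
  then obtain q where q: "q \<in> Q" "rank Q q = min (nat \<lfloor>s\<rfloor>) (card Q - 1)" by auto
  have "0 \<le> (w i - w q) * (c i - X i)" if i: "i \<in> Q" for i
  proof (cases i q rule: linorder_cases)
    case less
    then have "rank Q i + 1 \<le> nat \<lfloor>s\<rfloor>" using rank_strict_mono[OF Q i less] q(2) by simp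
    then have "real (rank Q i) + 1 \<le> s" by linarith
    then have "c i = 1" by (simp add: c_def clamp01_def)
    then show ?thesis using w[OF i q(1) less] X[OF i] by simp
  next
    case equal
    then show ?thesis by simp
  next
    case greater
    have "rank Q q < rank Q i" using rank_strict_mono[OF Q q(1) greater] .
    moreover have "rank Q i < card Q" using bij_betw_rank[OF Q] i by (auto simp: bij_betw_def)
    ultimately have "nat \<lfloor>s\<rfloor> + 1 \<le> rank Q i" using q(2) by linarith
    then have "s \<le> real (rank Q i)" by linarith
    then have "c i = 0" by (simp add: c_def clamp01_def)
    then show ?thesis using w[OF q(1) i greater] X[OF i] by (simp add: mult_nonpos_nonneg)
  qed
  then have "0 \<le> (\<Sum>i\<in>Q. (w i - w q) * (c i - X i))" by (rule sum_nonneg)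
  \<comment> \<open>Both fillings have the same total, so the reference weight \<open>w q\<close>
    drops out.\<close>
  also have "\<dots> = (\<Sum>i\<in>Q. w i * c i) - (\<Sum>i\<in>Q. w i * X i) - w q * (sum c Q - sum X Q)"
    by (simp add: sum_subtractf sum.distrib sum_distrib_left sum_distrib_right algebra_simps)
  also have "sum c Q = sum X Q"
    unfolding c_def using sum_clamp01_rank[OF Q s] by (simp add: s_def)
  finally show ?thesis by (simp add: c_def s_def)
qed auto

section \<open>Integral solutions\<close>

lemma sum_by_parts:
  fixes f g :: "nat \<Rightarrow> real"
  shows "(\<Sum>j=1..n. f j * g j) =
    (\<Sum>k<n. (f (Suc k) - f (Suc (Suc k))) * (\<Sum>j=1..Suc k. g j)) + f (Suc n) * (\<Sum>j=1..n. g j)"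
  by (induction n) (simp_all add: algebra_simps)

lemma sum_telescope_from_1:
  fixes f :: "nat \<Rightarrow> real"
  shows "(\<Sum>j=1..k. f j - f (j - 1)) = f k - f 0"
  by (induction k) simp_all

lemma Ints_unit_interval:
  fixes x :: real
  assumes "x \<in> \<int>" "0 \<le> x" "x \<le> 1"
  shows "x \<in> {0, 1}"
  using assms by (auto elim!: Ints_cases)

locale fair_ranking =
  fixes m n p :: nat and P :: "nat \<Rightarrow> nat set" and U :: "nat \<Rightarrow> nat \<Rightarrow> nat"
    and W :: "nat \<Rightarrow> nat \<Rightarrow> real"
  assumes n: "1 \<le> n" and P: "\<And>l. l \<in> {1..p} \<Longrightarrow> P l \<subseteq> {1..m}"
    and disj: "disjoint_family_on P {1..p}"
    and W: "monotone_Monge m n W"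
begin

text \<open>Class \<open>0\<close> collects the items that have none of the properties.\<close>

definition class_of :: "nat \<Rightarrow> nat" where
  "class_of i = (if \<exists>l\<in>{1..p}. i \<in> P l then THE l. l \<in> {1..p} \<and> i \<in> P l else 0)"

definition Q :: "nat \<Rightarrow> nat set" where
  "Q l = {i\<in>{1..m}. class_of i = l}"

section \<open>Partition of the items into classes\<close>

lemma class_of_eq:
  assumes "l \<in> {1..p}" "i \<in> P l"
  shows "class_of i = l"
proof -
  have "l' = l" if "l' \<in> {1..p}" "i \<in> P l'" for l'
    using disjoint_family_onD[OF disj that(1) assms(1)] that(2) assms(2) by blast
  then have "(THE l. l \<in> {1..p} \<and> i \<in> P l) = l" using assms by blast
  then show ?thesis unfolding class_of_def using assms by auto
qed

lemma class_of_cases: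
  obtains l where "l \<in> {1..p}" "i \<in> P l" "class_of i = l"
  | "\<And>l. l \<in> {1..p} \<Longrightarrow> i \<notin> P l" "class_of i = 0"
  using class_of_eq by (cases "\<exists>l\<in>{1..p}. i \<in> P l") (auto simp: class_of_def)

lemma Q_eq:
  assumes "l \<in> {1..p}"
  shows "Q l = P l"
proof
  show "P l \<subseteq> Q l" using P[OF assms] class_of_eq[OF assms] by (auto simp: Q_def)
  show "Q l \<subseteq> P l"
  proof
    fix i assume "i \<in> Q l"
    with assms show "i \<in> P l" by (cases i rule: class_of_cases) (auto simp: Q_def)
  qed
qed

lemma finite_Q: "finite (Q l)"
  by (simp add: Q_def)

lemma Q_subset: "Q l \<subseteq> {1..m}"
  by (auto simp: Q_def)

lemma class_of_le: "class_of i \<in> {0..p}"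
  by (cases i rule: class_of_cases) auto

lemma sum_over_classes: "(\<Sum>i=1..m. f i) = (\<Sum>l=0..p. \<Sum>i\<in>Q l. f i)" for f :: "nat \<Rightarrow> real"
  unfolding Q_def by (rule sum.group[symmetric]) (use class_of_le in auto)

text \<open>The hypotheses do not make column \<open>n\<close> of \<open>W\<close> antitone. Replacing its entries by the
  maxima over the later items of the same class does, and it preserves the Monge inequalities
  inside each class.\<close>

definition V :: "nat \<Rightarrow> nat \<Rightarrow> real" where
  "V i j = (if j < n then W i j
    else if j = n then Max ((\<lambda>i'. W i' n) ` {i'\<in>Q (class_of i). i \<le> i'}) else 0)"

text \<open>The coefficient of the prefix sum over the first \<open>k\<close> columns after
  summation by parts, hence the item weight in the \<open>k\<close>-th knapsack.\<close>

definition w :: "nat \<Rightarrow> nat \<Rightarrow> real" where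
  "w k i = V i k - V i (Suc k)"

section \<open>Suffix maxima in the last column and antitone knapsack weights\<close>

lemma V_last_ge: "i' \<in> Q (class_of i) \<Longrightarrow> i \<le> i' \<Longrightarrow> W i' n \<le> V i n"
  unfolding V_def using finite_Q by (auto intro!: Max_ge)

lemma V_last_attained:
  assumes "i \<in> {1..m}"
  obtains i' where "i' \<in> Q (class_of i)" "i \<le> i'" "V i n = W i' n"
proof -
  have "i \<in> Q (class_of i)" using assms by (simp add: Q_def)
  then have "V i n \<in> (\<lambda>i'. W i' n) ` {i'\<in>Q (class_of i). i \<le> i'}"
    unfolding V_def using finite_Q by (auto intro!: Max_in)
  then show ?thesis using that by auto
qed

lemma W_le_V: "i \<in> {1..m} \<Longrightarrow> j \<in> {1..n} \<Longrightarrow> W i j \<le> V i j"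
  using V_last_ge[of i i] by (cases "j < n") (auto simp: V_def Q_def)

text \<open>Before column \<open>n\<close> is involved this is the Monge inequality for adjacent
  columns, and for \<open>k = n\<close> it holds because suffix maxima decrease. The mixed case
  \<open>Suc k = n\<close> compares an original column with the column of maxima.\<close>

lemma w_antitone:
  assumes i: "i \<in> Q l" and i': "i' \<in> Q l" and "i < i'" and k: "k \<in> {1..n}"
  shows "w k i' \<le> w k i"
proof -
  have m: "i \<in> {1..m}" "i' \<in> {1..m}" and cl: "class_of i = l" "class_of i' = l"
    using i i' by (auto simp: Q_def)
  have last: "V i' n \<le> V i n"
  proof -
    obtain a where "a \<in> Q l" "i' \<le> a" "V i' n = W a n"
      using V_last_attained[OF m(2)] cl by auto
    then show ?thesis using V_last_ge[of a i] cl \<open>i < i'\<close> by simp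
  qed
  have Monge: "W i j1 + W i' j2 \<ge> W i j2 + W i' j1" "W i j1 \<ge> W i' j1"
    if "1 \<le> j1" "j1 < j2" "j2 \<le> n" "i < i'" "i \<in> {1..m}" "i' \<in> {1..m}" for i i' j1 j2
    using W that unfolding monotone_Monge_def by auto
  consider "Suc k < n" | "Suc k = n" | "k = n" using k by fastforce
  then show ?thesis
  proof cases
    case 1
    then show ?thesis using Monge(1)[of k "Suc k" i i'] m k \<open>i < i'\<close> by (simp add: w_def V_def)
  next
    case 2
    have "V i n - V i' n \<le> W i k - W i' k"
    proof -
      obtain a where a: "a \<in> Q l" "i \<le> a" "V i n = W a n"
        using V_last_attained[OF m(1)] cl by auto
      have am: "a \<in> {1..m}" using a Q_subset by blast
      have mono: "W i' k \<le> W i k" using Monge(2)[of k n i i'] m k 2 \<open>i < i'\<close> by simp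
      \<comment> \<open>If the maximizer \<open>a\<close> precedes \<open>i'\<close>, the Monge
        inequality for \<open>a\<close> and \<open>i'\<close> applies and column \<open>k\<close>
        decreases from \<open>i\<close> to \<open>a\<close>. Otherwise \<open>a\<close> also
        competes in the maximum for \<open>i'\<close>, so the left side is at most 0.\<close>
      show ?thesis
      proof (cases "a < i'")
        case True
        have "W a n + W i' k \<le> W a k + W i' n" using Monge(1)[of k n a i'] am m k 2 True by simp
        moreover have "W a k \<le> W i k" using Monge(2)[of k n i a] am m k 2 a(2) by (cases "i = a") auto
        moreover have "W i' n \<le> V i' n" using V_last_ge[of i' i'] cl i' by simp
        ultimately show ?thesis using a(3) by simp
      next
        case False
        then have "W a n \<le> V i' n" using V_last_ge[of a i'] a cl by simp
        then show ?thesis using a(3) mono by simp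
      qed
    qed
    then show ?thesis using 2 by (auto simp: w_def V_def)
  next
    case 3
    then show ?thesis using last by (simp add: w_def V_def)
  qed
qed

section \<open>Prefix masses and the integral solutions they determine\<close>

lemma objective_by_parts:
  "(\<Sum>i=1..m. \<Sum>j=1..n. V i j * x i j) =
     (\<Sum>l=0..p. \<Sum>k<n. \<Sum>i\<in>Q l. w (Suc k) i * (\<Sum>j=1..Suc k. x i j))"
proof -
  \<comment> \<open>The default 0 beyond column \<open>n\<close> removes the boundary term of the
    summation by parts.\<close>
  have "V i (Suc n) = 0" for i by (simp add: V_def)
  then have "(\<Sum>j=1..n. V i j * x i j) = (\<Sum>k<n. w (Suc k) i * (\<Sum>j=1..Suc k. x i j))" for i
    unfolding sum_by_parts w_def by simp
  then show ?thesis unfolding sum_over_classes by (simp add: sum.swap[of _ "{..<n}"])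
qed

text \<open>Greedy fillings of a class grow with the column because \<open>T\<close> does, and are
  0/1 because \<open>T\<close> is integral; their successive differences form a 0/1 matrix. It has
  the desired value under \<open>V\<close>, and changing its last column transfers that value to
  \<open>W\<close>.\<close>

lemma integral_from_prefix_sums:
  fixes T :: "nat \<Rightarrow> nat \<Rightarrow> real"
  assumes T0: "\<And>l. l \<in> {0..p} \<Longrightarrow> T l 0 = 0"
    and T_mono: "\<And>l k. l \<in> {0..p} \<Longrightarrow> k < n \<Longrightarrow> T l k \<le> T l (Suc k)"
    and T_Ints: "\<And>l k. l \<in> {0..p} \<Longrightarrow> k \<le> n \<Longrightarrow> T l k \<in> \<int>"
    and T_sum: "\<And>k. k \<le> n \<Longrightarrow> (\<Sum>l=0..p. T l k) = k"
    and T_card: "\<And>l. l \<in> {0..p} \<Longrightarrow> T l n \<le> card (Q l)"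
    and T_U: "\<And>l k. l \<in> {1..p} \<Longrightarrow> k \<in> {1..n} \<Longrightarrow> T l k \<le> U k l"
  shows "\<exists>y\<in>LP_feasible m n p P U. (\<forall>i\<in>{1..m}. \<forall>j\<in>{1..n}. y i j \<in> {0, 1}) \<and>
    LP_objective m n W y =
      (\<Sum>l=0..p. \<Sum>k<n. \<Sum>i\<in>Q l. w (Suc k) i * clamp01 (T l (Suc k) - rank (Q l) i))"
proof -
  define X where "X i k = clamp01 (T (class_of i) k - rank (Q (class_of i)) i)" for i k
  define x where "x i j = X i j - X i (j - 1)" for i j
  have X0: "X i 0 = 0" for i
    using T0[OF class_of_le] by (simp add: X_def clamp01_def)
  have prefix: "(\<Sum>j=1..k. x i j) = X i k" for i k
    unfolding x_def sum_telescope_from_1 X0 by simp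
  have T_mono': "T l k \<le> T l k'" if "l \<in> {0..p}" "k \<le> k'" "k' \<le> n" for l k k'
    using that(2,3)
  proof (induction rule: dec_induct)
    case (step k')
    then show ?case using T_mono[OF that(1), of k'] by simp
  qed simp
  have T_nonneg: "0 \<le> T l k" if "l \<in> {0..p}" "k \<le> n" for l k
    using T_mono'[OF that(1), of 0 k] T0 that by simp
  have class_sum: "(\<Sum>i\<in>Q l. X i k) = T l k" if "l \<in> {0..p}" "k \<le> n" for l k
  proof -
    have "(\<Sum>i\<in>Q l. X i k) = (\<Sum>i\<in>Q l. clamp01 (T l k - rank (Q l) i))"
      by (rule sum.cong) (auto simp: X_def Q_def)
    then show ?thesis
      using sum_clamp01_rank[OF finite_Q T_nonneg[OF that]] T_mono'[OF that(1,2)] T_card[OF that(1)]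
      by fastforce
  qed
  have X_Ints: "X i k \<in> \<int>" if "k \<le> n" for i k
    unfolding X_def using T_Ints[OF class_of_le that] by (intro clamp01_Ints Ints_diff) auto
  have X_mono: "X i k \<le> X i k'" if "k \<le> k'" "k' \<le> n" for i k k'
    unfolding X_def using T_mono'[OF class_of_le that] by (intro clamp01_mono) simp
  have X_bounds: "0 \<le> X i k" "X i k \<le> 1" for i k
    by (simp_all add: X_def clamp01_bounds)
  have x01: "x i j \<in> {0, 1}" if "j \<in> {1..n}" for i j
  proof (rule Ints_unit_interval)
    show "x i j \<in> \<int>" unfolding x_def using that by (intro Ints_diff X_Ints) auto
    show "0 \<le> x i j" unfolding x_def using X_mono[of "j - 1" j i] that by simp
    show "x i j \<le> 1" unfolding x_def using X_bounds[of i] by (smt (verit))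
  qed
  have X_sum: "(\<Sum>i=1..m. X i k) = k" if "k \<le> n" for k
    unfolding sum_over_classes using T_sum[OF that] that by (simp add: class_sum)
  have col: "(\<Sum>i=1..m. x i j) = 1" if "j \<in> {1..n}" for j
  proof -
    have "j - 1 \<le> n" "1 \<le> j" using that by auto
    then show ?thesis
      using that X_sum[of j] X_sum[of "j - 1"] by (simp add: x_def sum_subtractf of_nat_diff)
  qed
  have "\<exists>a\<in>{1..m}. x a n \<noteq> 0"
  proof (rule ccontr)
    assume "\<not> ?thesis"
    then have "(\<Sum>i=1..m. x i n) = 0" by (intro sum.neutral) blast
    then show False using col[of n] n by simp
  qed
  then obtain a where a: "a \<in> {1..m}" "x a n = 1" using x01[of n] n by force
  have x_last: "x i n = of_bool (i = a)" if "i \<in> {1..m}" for i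
  proof (rule ccontr)
    assume neq: "x i n \<noteq> of_bool (i = a)"
    then have "i \<noteq> a" "x i n = 1" using a(2) x01[of n i] n by auto
    then have "(\<Sum>i'\<in>{a, i}. x i' n) = 2" using a by simp
    moreover have "(\<Sum>i'\<in>{a, i}. x i' n) \<le> (\<Sum>i'=1..m. x i' n)"
    proof (rule sum_mono2)
      show "0 \<le> x i' n" for i' using x01[of n i'] n by auto
    qed (use that a in auto)
    ultimately show False using col[of n] n by simp
  qed
  obtain b where b: "b \<in> Q (class_of a)" "a \<le> b" "V a n = W b n"
    using V_last_attained[OF a(1)] .
  have cl_b: "class_of b = class_of a" and bm: "b \<in> {1..m}" using b(1) by (auto simp: Q_def)
  \<comment> \<open>Since \<open>a\<close> is taken only in column \<open>n\<close>, the earlier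
    mass of its class does not exceed the rank of \<open>a\<close>, hence not that of
    \<open>b\<close>.\<close>
  have b_free: "X b (n - 1) = 0"
  proof -
    have "X a (n - 1) = 0" using a(2) X_bounds[of a n] X_bounds[of a "n - 1"] by (simp add: x_def)
    then have "T (class_of a) (n - 1) \<le> rank (Q (class_of a)) a"
      by (auto simp: X_def clamp01_def min_def max_def split: if_splits)
    also have "rank (Q (class_of a)) a \<le> rank (Q (class_of a)) b"
      unfolding rank_def using b(2) finite_Q by (intro card_mono) auto
    finally show ?thesis by (simp add: X_def cl_b clamp01_def)
  qed
  \<comment> \<open>In column \<open>n\<close> the greedy item \<open>a\<close> is exchanged for the later item \<open>b\<close> of its class that attains
    the maximum in \<open>V\<close>; the rank order guarantees that \<open>b\<close> is not used in earlier columns.\<close>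
  define y where "y i j = (if j = n then of_bool (i = b) else x i j)" for i j
  have y_prefix: "(\<Sum>j=1..k. y i j) = X i k" if "k < n" for i k
    unfolding prefix[symmetric] by (rule sum.cong) (use that in \<open>auto simp: y_def\<close>)
  have split_last: "(\<Sum>j=1..n. f j) = (\<Sum>j=1..n - 1. f j) + f n" for f :: "nat \<Rightarrow> real"
    using n by (cases n) auto
  have y_total: "(\<Sum>j=1..n. y i j) = X i (n - 1) + of_bool (i = b)" for i
    unfolding split_last using y_prefix[of "n - 1" i] n by (simp add: y_def)
  have y01: "y i j \<in> {0, 1}" if "j \<in> {1..n}" for i j
    using x01[OF that] by (auto simp: y_def)
  have "y \<in> Omega m n"
    unfolding Omega_def
  proof (intro CollectI conjI ballI)
    fix i j assume "j \<in> {1..n}"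
    then show "y i j \<in> {0..1}" using y01[of j i] by auto
  next
    fix i
    show "(\<Sum>j=1..n. y i j) \<le> 1"
      unfolding y_total using b_free X_bounds[of i "n - 1"] by auto
  next
    fix j assume j: "j \<in> {1..n}"
    show "(\<Sum>i=1..m. y i j) = 1"
      using col[OF j] bm by (cases "j = n") (auto simp: y_def)
  qed
  moreover have "(\<Sum>i\<in>P l. \<Sum>j=1..k. y i j) \<le> real (U k l)" if l: "l \<in> {1..p}" and k: "k \<in> {1..n}" for l k
  proof -
    have "(\<Sum>i\<in>P l. \<Sum>j=1..k. y i j) = (\<Sum>i\<in>Q l. X i k)"
    proof (cases "k = n")
      case False
      then show ?thesis using y_prefix[of k] Q_eq[OF l] k by simp
    next
      case True
      \<comment> \<open>The exchanged items share a class, so every class mass is unchanged.\<close>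
      have "(\<Sum>i\<in>Q l. of_bool (i = b)) = (\<Sum>i\<in>Q l. of_bool (i = a) :: real)"
        using a(1) bm cl_b finite_Q[of l] by (cases "class_of a = l") (auto simp: Q_def intro!: sum.neutral)
      also have "\<dots> = (\<Sum>i\<in>Q l. x i n)"
        by (rule sum.cong) (use x_last Q_subset[of l] in auto)
      finally show ?thesis
        unfolding True y_total Q_eq[OF l, symmetric] by (simp add: sum.distrib x_def sum_subtractf)
    qed
    then show ?thesis using class_sum[of l k] T_U[OF l k] l k by simp
  qed
  ultimately have feas: "y \<in> LP_feasible m n p P U" by (simp add: LP_feasible_def)
  have "LP_objective m n W y = (\<Sum>i=1..m. \<Sum>j=1..n. V i j * x i j)"
  proof -
    \<comment> \<open>Each side has a single nonzero indicator: \<open>b\<close> on the left,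
      \<open>a\<close> on the right, and \<open>W b n = V a n\<close>.\<close>
    have "(\<Sum>i=1..m. W i n * y i n) = (\<Sum>i=1..m. V i n * x i n)"
      using x_last a(1) bm b(3) by (simp add: y_def)
    moreover have "(\<Sum>j=1..n - 1. W i j * y i j) = (\<Sum>j=1..n - 1. V i j * x i j)" for i
      by (rule sum.cong) (use n in \<open>auto simp: y_def V_def\<close>)
    ultimately show ?thesis unfolding LP_objective_def split_last by (simp add: sum.distrib)
  qed
  also have "\<dots> = (\<Sum>l=0..p. \<Sum>k<n. \<Sum>i\<in>Q l. w (Suc k) i * clamp01 (T l (Suc k) - rank (Q l) i))"
    unfolding objective_by_parts prefix by (intro sum.cong) (auto simp: X_def Q_def)
  finally show ?thesis using feas y01 by blast
qed

text \<open>Chain of bounds: passing from \<open>W\<close> to \<open>V\<close> only increases the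
  objective as \<open>x\<close> is nonnegative, greedy filling bounds each knapsack, and rounding
  does not lower the sum of knapsack values, which the integral matrix attains under
  \<open>W\<close>.\<close>

lemma integral_dominates:
  assumes x: "x \<in> LP_feasible m n p P U"
  shows "\<exists>y\<in>LP_feasible m n p P U. (\<forall>i\<in>{1..m}. \<forall>j\<in>{1..n}. y i j \<in> {0, 1}) \<and>
    LP_objective m n W x \<le> LP_objective m n W y"
proof -
  have x01: "0 \<le> x i j" if "i \<in> {1..m}" "j \<in> {1..n}" for i j
    using x that by (auto simp: LP_feasible_def Omega_def)
  have row: "(\<Sum>j=1..n. x i j) \<le> 1" if "i \<in> {1..m}" for i
    using x that by (auto simp: LP_feasible_def Omega_def)
  have col: "(\<Sum>i=1..m. x i j) = 1" if "j \<in> {1..n}" for j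
    using x that by (auto simp: LP_feasible_def Omega_def)
  define X where "X i k = (\<Sum>j=1..k. x i j)" for i k
  have X: "0 \<le> X i k" "X i k \<le> 1" if "i \<in> {1..m}" "k \<le> n" for i k
  proof -
    show "0 \<le> X i k" unfolding X_def using x01 that by (intro sum_nonneg) auto
    have "X i k \<le> (\<Sum>j=1..n. x i j)"
      unfolding X_def by (rule sum_mono2) (use x01 that in auto)
    then show "X i k \<le> 1" using row that by force
  qed
  define S where "S l k = (\<Sum>i\<in>Q l. X i k)" for l k
  \<comment> \<open>The increment of \<open>\<phi> l k\<close> over the unit interval starting at
    the floor of \<open>S l k\<close>, used as the cost in the rounding.\<close>
  define slope where "slope l k = (\<Sum>i\<in>Q l. w k i *
    (clamp01 (of_int \<lfloor>S l k\<rfloor> + 1 - rank (Q l) i) - clamp01 (of_int \<lfloor>S l k\<rfloor> - rank (Q l) i)))" for l k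
  define \<phi> where "\<phi> l k s = (\<Sum>i\<in>Q l. w k i * clamp01 (s - rank (Q l) i))" for l k and s :: real
  have affine: "\<phi> l k s = \<phi> l k (S l k) + slope l k * (s - S l k)"
    if "of_int \<lfloor>S l k\<rfloor> \<le> s" "s \<le> of_int \<lceil>S l k\<rceil>" for l k s
    unfolding \<phi>_def slope_def sum_distrib_right sum.distrib[symmetric]
    by (rule sum.cong) (simp_all add: clamp01_affine_between_integers[OF that] algebra_simps)
  have S0: "S l 0 = 0" if "l \<in> {0..p}" for l by (simp add: S_def X_def)
  have S_mono: "S l k \<le> S l (Suc k)" if "l \<in> {0..p}" "k < n" for l k
    unfolding S_def X_def by (rule sum_mono) (use x01 that Q_subset[of l] in auto)
  have S_sum: "(\<Sum>l=0..p. S l k) = k" if "k \<le> n" for k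
  proof -
    have "(\<Sum>l=0..p. S l k) = (\<Sum>j=1..k. \<Sum>i=1..m. x i j)"
      unfolding S_def sum_over_classes[symmetric] X_def by (rule sum.swap)
    also have "\<dots> = (\<Sum>j=1..k. 1)" by (rule sum.cong) (use col that in auto)
    finally show ?thesis by simp
  qed
  obtain T where T0: "\<And>l. l \<in> {0..p} \<Longrightarrow> T l 0 = 0"
    and T_mono: "\<And>l k. l \<in> {0..p} \<Longrightarrow> k < n \<Longrightarrow> T l k \<le> T l (Suc k)"
    and T: "\<And>l k. l \<in> {0..p} \<Longrightarrow> k \<le> n \<Longrightarrow>
      T l k \<in> \<int> \<and> of_int \<lfloor>S l k\<rfloor> \<le> T l k \<and> T l k \<le> of_int \<lceil>S l k\<rceil>"
    and T_sum: "\<And>k. k \<le> n \<Longrightarrow> (\<Sum>l=0..p. T l k) = k"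
    and T_obj: "(\<Sum>l=0..p. \<Sum>k<n. slope l (Suc k) * S l (Suc k))
      \<le> (\<Sum>l=0..p. \<Sum>k<n. slope l (Suc k) * T l (Suc k))"
    by (rule round_prefix_sums[of "{0..p}" S n slope, OF finite_atLeastAtMost S0 S_mono S_sum that])
  \<comment> \<open>Rounding up never crosses a natural number bound, so both the class sizes and
    the capacities \<open>U\<close> remain respected.\<close>
  have T_le: "T l k \<le> real N" if "l \<in> {0..p}" "k \<le> n" "S l k \<le> real N" for l k N
  proof -
    have "\<lceil>S l k\<rceil> \<le> int N" using that(3) by (simp add: ceiling_le_iff)
    then show ?thesis using T[OF that(1,2)] by linarith
  qed
  have "\<exists>y\<in>LP_feasible m n p P U. (\<forall>i\<in>{1..m}. \<forall>j\<in>{1..n}. y i j \<in> {0, 1}) \<and>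
    LP_objective m n W y =
      (\<Sum>l=0..p. \<Sum>k<n. \<Sum>i\<in>Q l. w (Suc k) i * clamp01 (T l (Suc k) - rank (Q l) i))"
  proof (rule integral_from_prefix_sums)
    show "T l n \<le> card (Q l)" if "l \<in> {0..p}" for l
    proof (rule T_le[OF that])
      have "(\<Sum>i\<in>Q l. X i n) \<le> (\<Sum>i\<in>Q l. 1)"
        by (rule sum_mono) (use X Q_subset[of l] in auto)
      then show "S l n \<le> real (card (Q l))" by (simp add: S_def)
    qed simp
    show "T l k \<le> U k l" if "l \<in> {1..p}" "k \<in> {1..n}" for l k
    proof (rule T_le)
      show "S l k \<le> real (U k l)"
        using x that Q_eq[OF that(1)] by (simp add: S_def X_def LP_feasible_def)
    qed (use that in auto)
  qed (use T0 T_mono T T_sum in auto)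
  then obtain y where y: "y \<in> LP_feasible m n p P U" "\<forall>i\<in>{1..m}. \<forall>j\<in>{1..n}. y i j \<in> {0, 1}"
    and y_obj: "LP_objective m n W y = (\<Sum>l=0..p. \<Sum>k<n. \<phi> l (Suc k) (T l (Suc k)))"
    unfolding \<phi>_def by blast
  have "LP_objective m n W x \<le> (\<Sum>i=1..m. \<Sum>j=1..n. V i j * x i j)"
    unfolding LP_objective_def using W_le_V x01 by (intro sum_mono mult_right_mono) auto
  also have "\<dots> \<le> (\<Sum>l=0..p. \<Sum>k<n. \<phi> l (Suc k) (S l (Suc k)))"
    unfolding objective_by_parts X_def[symmetric] \<phi>_def S_def
  proof (rule sum_mono, rule sum_mono, rule fractional_knapsack[OF finite_Q])
    fix l k i
    assume "k \<in> {..<n}" "i \<in> Q l"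
    then show "0 \<le> X i (Suc k) \<and> X i (Suc k) \<le> 1" using X[of i "Suc k"] Q_subset[of l] by auto
  next
    fix l k i i'
    assume "k \<in> {..<n}" "i \<in> Q l" "i' \<in> Q l" "i < i'"
    then show "w (Suc k) i' \<le> w (Suc k) i" by (intro w_antitone[of i l i']) auto
  qed
  also have "\<dots> \<le> (\<Sum>l=0..p. \<Sum>k<n. \<phi> l (Suc k) (T l (Suc k)))"
  proof -
    have "(\<Sum>l=0..p. \<Sum>k<n. \<phi> l (Suc k) (T l (Suc k))) =
        (\<Sum>l=0..p. \<Sum>k<n. \<phi> l (Suc k) (S l (Suc k)) +
          (slope l (Suc k) * T l (Suc k) - slope l (Suc k) * S l (Suc k)))"
    proof (intro sum.cong refl)
      fix l k assume "l \<in> {0..p}" "k \<in> {..<n}"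
      then show "\<phi> l (Suc k) (T l (Suc k)) = \<phi> l (Suc k) (S l (Suc k)) +
          (slope l (Suc k) * T l (Suc k) - slope l (Suc k) * S l (Suc k))"
        using affine[of l "Suc k" "T l (Suc k)"] T[of l "Suc k"] by (simp add: right_diff_distrib)
    qed
    also have "\<dots> = (\<Sum>l=0..p. \<Sum>k<n. \<phi> l (Suc k) (S l (Suc k))) +
        ((\<Sum>l=0..p. \<Sum>k<n. slope l (Suc k) * T l (Suc k)) -
         (\<Sum>l=0..p. \<Sum>k<n. slope l (Suc k) * S l (Suc k)))"
      by (simp only: sum.distrib sum_subtractf)
    finally show ?thesis using T_obj by linarith
  qed
  finally have "LP_objective m n W x \<le> LP_objective m n W y" unfolding y_obj .
  with y show ?thesis by blast
qed

end

theorem theorem7: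
  fixes m n p :: nat
    and P :: "nat \<Rightarrow> nat set"
    and U :: "nat \<Rightarrow> nat \<Rightarrow> nat"
    and W :: "nat \<Rightarrow> nat \<Rightarrow> real"
  assumes "1 \<le> n" and "n \<le> m"
    and "\<forall>l\<in>{1..p}. P l \<subseteq> {1..m}"
    and "disjoint_family_on P {1..p}"
    and "\<forall>i\<in>{1..m}. \<forall>j\<in>{1..n}. 0 \<le> W i j"
    and "monotone_Monge m n W"
    and feasible: "LP_feasible m n p P U \<noteq> {}"
  shows "\<exists>x. LP_optimal m n p P U W x \<and> (\<forall>i\<in>{1..m}. \<forall>j\<in>{1..n}. x i j \<in> {0, 1})"
proof -
  interpret fair_ranking m n p P U W
    using assms by unfold_locales auto
  define I where "I = {y\<in>LP_feasible m n p P U. \<forall>i\<in>{1..m}. \<forall>j\<in>{1..n}. y i j \<in> {0, 1}}"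
  \<comment> \<open>Entries outside the index range are free, so \<open>I\<close> itself need not be
    finite. The objective only sees the set of positions holding a 1, and there are finitely many
    such sets.\<close>
  have "LP_objective m n W ` I \<subseteq>
      (\<lambda>A. LP_objective m n W (\<lambda>i j. of_bool ((i, j) \<in> A))) ` Pow ({1..m} \<times> {1..n})"
  proof
    fix v assume "v \<in> LP_objective m n W ` I"
    then obtain y where y: "y \<in> I" "v = LP_objective m n W y" by blast
    define A where "A = {(i, j). i \<in> {1..m} \<and> j \<in> {1..n} \<and> y i j = 1}"
    have "v = LP_objective m n W (\<lambda>i j. of_bool ((i, j) \<in> A))"
      unfolding y(2) LP_objective_def by (intro sum.cong refl) (use y(1) in \<open>force simp: I_def A_def\<close>)
    then show "v \<in> (\<lambda>A. LP_objective m n W (\<lambda>i j. of_bool ((i, j) \<in> A))) ` Pow ({1..m} \<times> {1..n})"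
      by (rule image_eqI) (auto simp: A_def)
  qed
  then have fin: "finite (LP_objective m n W ` I)" by (rule finite_subset) simp
  have "I \<noteq> {}" using feasible integral_dominates by (force simp: I_def)
  then have "Max (LP_objective m n W ` I) \<in> LP_objective m n W ` I" using fin by (intro Max_in) auto
  then obtain x where x: "x \<in> I" "LP_objective m n W x = Max (LP_objective m n W ` I)" by auto
  have "LP_objective m n W y \<le> LP_objective m n W x" if y: "y \<in> LP_feasible m n p P U" for y
  proof -
    obtain z where "z \<in> I" "LP_objective m n W y \<le> LP_objective m n W z"
      using integral_dominates[OF y] by (auto simp: I_def)
    then show ?thesis using x(2) fin by (smt (verit) Max_ge image_eqI)
  qed
  then have "LP_optimal m n p P U W x"
    using x(1) by (auto simp: LP_optimal_def is_arg_max_def I_def not_less)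
  then show ?thesis using x(1) by (auto simp: I_def)
qed

end
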